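(* Let $S\subseteq\mathbb{N}^\mathbb{N}$ and let $\alpha$ be an ordinal. Then $S$ is guessable with $<\alpha$ mind changes if and only if $S_\alpha=\emptyset$.
   Context: $\mathbb{N}^{<\mathbb{N}}$ is the set of finite sequences of naturals; $f\upharpoonright n$ is the length-$n$ initial segment of $f\in\mathbb{N}^\mathbb{N}$; $\chi_S$ is the characteristic function of $S$. A function $G:\mathbb{N}^{<\mathbb{N}}\to\{0,1\}$ is an $S$-guesser if $\lim_{n\to\infty}G(f\upharpoonright n)=\chi_S(f)$ for all $f\in\mathbb{N}^\mathbb{N}$. $G$ changes its mind on $f\upharpoonright(n+1)$ if $G(f\upharpoonright(n+1))\ne G(f\upharpoonright n)$. $S$ is guessable with $<\alpha$ mind changes if there are an $S$-guesser $G$ and a function $H:\mathbb{N}^{<\mathbb{N}}\to\alpha$ (i.e. with values ordinals $<\alpha$) such that for all $f\in\mathbb{N}^\mathbb{N}$, $n\in\mathbb{N}$: (i) $H(f\upharpoonright(n+1))\le H(f\upharpoonright n)$; (ii) if $G$ changes its mind on $f\upharpoonright(n+1)$ then $H(f\upharpoonright(n+1))<H(f\upharpoonright n)$. For $X\subseteq\mathbb{N}^{<\mathbb{N}}$, $[X]$ is the set of $f\in\mathbb{N}^\mathbb{N}$ all of whose finite initial segments lie in $X$. Define $S_\alpha\subseteq\mathbb{N}^{<\mathbb{N}}$ by: $S_0=\mathbb{N}^{<\mathbb{N}}$; $S_\lambda=\bigcap_{\beta<\lambda}S_\beta$ for limit $\lambda$; $S_{\beta+1}=\{x\in S_\beta: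 \exists x',x''\in[S_\beta] \text{ extending } x \text{ with } x'\in S,\ x''\notin S\}$. *)

theory Defs
  imports Complex_Main "HOL-Library.Indicator_Function"
begin

definition initial_segment :: "(nat \<Rightarrow> nat) \<Rightarrow> nat \<Rightarrow> nat list" where
  "initial_segment f n = map f [0..<n]"

definition extends :: "(nat \<Rightarrow> nat) \<Rightarrow> nat list \<Rightarrow> bool" where
  "extends f x \<longleftrightarrow> (\<exists>n. initial_segment f n = x)"

definition body :: "nat list set \<Rightarrow> (nat \<Rightarrow> nat) set" where
  "body X = {f. \<forall>n. initial_segment f n \<in> X}"

text \<open>The limit is taken in the discrete space of naturals.\<close>

definition guesser :: "(nat \<Rightarrow> nat) set \<Rightarrow> (nat list \<Rightarrow> nat) \<Rightarrow> bool" where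
  "guesser S G \<longleftrightarrow>
     range G \<subseteq> {0, 1} \<and>
     (\<forall>f. (\<lambda>n. G (initial_segment f n)) \<longlonglongrightarrow> (indicator S f :: nat))"

definition changes_mind :: "(nat list \<Rightarrow> nat) \<Rightarrow> (nat \<Rightarrow> nat) \<Rightarrow> nat \<Rightarrow> bool" where
  "changes_mind G f n \<longleftrightarrow> G (initial_segment f (Suc n)) \<noteq> G (initial_segment f n)"

text \<open>
  An ordinal is an element \<open>\<alpha>\<close> of an arbitrary type of class \<open>wellorder\<close>; it stands for
  the order type of \<open>{..<\<alpha>}\<close>. As the type is a free type variable, this covers all ordinals:
  \<open>\<alpha>\<close> occurs as the top element of a well-order of type \<open>\<alpha> + 1\<close>. The ordinals
  below \<open>\<alpha>\<close> are the elements below \<open>\<alpha>\<close>.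
\<close>

definition guessable_with_less ::
    "(nat \<Rightarrow> nat) set \<Rightarrow> 'o::wellorder \<Rightarrow> bool" where
  "guessable_with_less S \<alpha> \<longleftrightarrow>
     (\<exists>G. \<exists>H :: nat list \<Rightarrow> 'o.
        guesser S G \<and> range H \<subseteq> {..<\<alpha>} \<and>
        (\<forall>f n. H (initial_segment f (Suc n)) \<le> H (initial_segment f n) \<and>
               (changes_mind G f n \<longrightarrow>
                  H (initial_segment f (Suc n)) < H (initial_segment f n))))"

definition is_zero :: "'o::wellorder \<Rightarrow> bool" where
  "is_zero \<alpha> \<longleftrightarrow> (\<forall>\<beta>. \<alpha> \<le> \<beta>)"

definition is_successor_of :: "'o::wellorder \<Rightarrow> 'o \<Rightarrow> bool" where
  "is_successor_of \<alpha> \<beta> \<longleftrightarrow> \<beta> < \<alpha> \<and> (\<forall>\<gamma>. \<beta> < \<gamma> \<longrightarrow> \<alpha> \<le> \<gamma>)"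

definition is_limit :: "'o::wellorder \<Rightarrow> bool" where
  "is_limit \<alpha> \<longleftrightarrow> \<not> is_zero \<alpha> \<and> (\<nexists>\<beta>. is_successor_of \<alpha> \<beta>)"

definition predecessor :: "'o::wellorder \<Rightarrow> 'o" where
  "predecessor \<alpha> = (THE \<beta>. is_successor_of \<alpha> \<beta>)"

lemma predecessor_eq: "is_successor_of \<alpha> \<beta> \<Longrightarrow> predecessor \<alpha> = \<beta>"
  unfolding predecessor_def is_successor_of_def
  by (rule the_equality) (auto, metis leD neqE)

lemma predecessor_less: "\<not> is_zero \<alpha> \<Longrightarrow> \<not> is_limit \<alpha> \<Longrightarrow> predecessor \<alpha> < \<alpha>"
  by (metis is_limit_def is_successor_of_def predecessor_eq)

definition derived :: "(nat \<Rightarrow> nat) set \<Rightarrow> nat list set \<Rightarrow> nat list set" where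
  "derived S X =
     {x \<in> X. \<exists>x' \<in> body X. \<exists>x'' \<in> body X.
        extends x' x \<and> extends x'' x \<and> x' \<in> S \<and> x'' \<notin> S}"

function stage :: "(nat \<Rightarrow> nat) set \<Rightarrow> 'o::wellorder \<Rightarrow> nat list set" where
  "stage S \<alpha> =
     (if is_zero \<alpha> then UNIV
      else if is_limit \<alpha> then (\<Inter>\<beta>\<in>{..<\<alpha>}. stage S \<beta>)
      else derived S (stage S (predecessor \<alpha>)))"
  by pat_completeness auto
termination
  by (relation "inv_image {(\<beta>, \<alpha>). \<beta> < \<alpha>} snd") (auto simp: wf predecessor_less)

declare stage.simps [simp del]

lemma stage_zero: "is_zero \<alpha> \<Longrightarrow> stage S \<alpha> = UNIV"
  by (simp add: stage.simps)

lemma stage_limit: "is_limit \<alpha> \<Longrightarrow> stage S \<alpha> = (\<Inter>\<beta>\<in>{..<\<alpha>}. stage S \<beta>)"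
  by (subst stage.simps) (metis is_limit_def)

lemma stage_successor: "is_successor_of \<alpha> \<beta> \<Longrightarrow> stage S \<alpha> = derived S (stage S \<beta>)"
proof -
  assume succ: "is_successor_of \<alpha> \<beta>"
  then have "\<not> is_zero \<alpha>" "\<not> is_limit \<alpha>"
    by (meson is_limit_def is_successor_of_def is_zero_def leD)+
  then show ?thesis
    by (subst stage.simps) (simp add: predecessor_eq[OF succ])
qed

end

theory Submission imports Defs begin

text \<open>
  Uniformly in \<open>\<beta>\<close>, the stage \<open>S\<^sub>\<beta>\<close> is the intersection of the derived sets of all earlier stages.
  If \<open>G\<close>, \<open>H\<close> witness guessability, then a sequence \<open>x \<in> S\<^sub>\<beta>\<close> can be continued inside an earlier
  stage so that \<open>G\<close> has to change its mind, and induction gives \<open>\<beta> \<le> H x\<close>; so \<open>S\<^sub>\<alpha>\<close> is empty.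
  Conversely, if \<open>S\<^sub>\<alpha>\<close> is empty, let \<open>H x\<close> be the least \<open>\<gamma>\<close> such that \<open>x\<close> is not in the derived
  set of \<open>S\<^sub>\<gamma>\<close>. Then \<open>x\<close> does not have extensions in \<open>[S\<^sub>\<gamma>]\<close> both inside and outside \<open>S\<close>, and
  \<open>G x\<close> tells which of the two occurs, as seen from the shortest prefix of \<open>x\<close> with the same
  rank; thus \<open>G\<close> is constant as long as \<open>H\<close> is.
\<close>

lemma length_initial_segment [simp]: "length (initial_segment f n) = n"
  by (simp add: initial_segment_def)

lemma take_initial_segment: "take k (initial_segment f n) = initial_segment f (min k n)"
  by (simp add: initial_segment_def take_map min_def)

lemma extends_initial_segment [simp]: "extends f (initial_segment f n)"
  by (auto simp: extends_def)

lemma extendsD: "extends f x \<Longrightarrow> initial_segment f (length x) = x"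
  by (auto simp: extends_def)

lemma extends_take: "extends f x \<Longrightarrow> extends f (take k x)"
  by (auto simp: extends_def take_initial_segment)

lemma body_extends: "f \<in> body X \<Longrightarrow> extends f x \<Longrightarrow> x \<in> X"
  by (auto simp: body_def extends_def)

lemma derived_subset: "derived S X \<subseteq> X"
  by (auto simp: derived_def)

text \<open>The two witnesses for \<open>x\<close> also extend its prefix. That the prefix lies in
  \<open>X\<close> comes from these witnesses, so \<open>X\<close> itself need not be closed under
  prefixes.\<close>

lemma take_in_derived: "x \<in> derived S X \<Longrightarrow> take k x \<in> derived S X"
  unfolding derived_def by (blast intro: extends_take body_extends)

text \<open>The type may have a largest element; the element above \<delta> is what makes a
  successor exist.\<close>

lemma ex_successor:
  fixes \<delta> \<beta> :: "'o::wellorder"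
  assumes "\<delta> < \<beta>"
  obtains \<gamma> where "is_successor_of \<gamma> \<delta>" "\<gamma> \<le> \<beta>"
proof
  show "is_successor_of (LEAST \<gamma>. \<delta> < \<gamma>) \<delta>"
    unfolding is_successor_of_def using LeastI[of "\<lambda>\<gamma>. \<delta> < \<gamma>", OF assms] by (auto intro: Least_le)
  show "(LEAST \<gamma>. \<delta> < \<gamma>) \<le> \<beta>"
    using assms by (rule Least_le)
qed

text \<open>This replaces the recursion by cases: the arguments below treat zero, successor and
  limit stages alike.\<close>

lemma stage_eq_Inter_derived:
  fixes \<beta> :: "'o::wellorder"
  shows "stage S \<beta> = (\<Inter>\<delta>\<in>{..<\<beta>}. derived S (stage S \<delta>))"
proof (induction \<beta> rule: less_induct)
  case (less \<beta>)
  consider "is_zero \<beta>" | \<gamma> where "is_successor_of \<beta> \<gamma>" | "is_limit \<beta>"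
    by (auto simp: is_limit_def)
  then show ?case
  proof cases
    case 1
    then have "{..<\<beta>} = {}"
      by (auto simp: is_zero_def dest: leD)
    with 1 show ?thesis
      by (simp add: stage_zero)
  next
    case 2
    then have "\<gamma> < \<beta>" by (simp add: is_successor_of_def)
    have "\<delta> < \<beta> \<longleftrightarrow> \<delta> = \<gamma> \<or> \<delta> < \<gamma>" for \<delta>
      using 2 unfolding is_successor_of_def by (metis leD neqE order_less_trans)
    then have below: "{..<\<beta>} = insert \<gamma> {..<\<gamma>}"
      by auto
    \<comment> \<open>By induction the stage at \<gamma> is already the intersection over all
      earlier ordinals, so the term for \<gamma> absorbs the others.\<close>
    have "derived S (stage S \<gamma>) \<subseteq> (\<Inter>\<delta>\<in>{..<\<gamma>}. derived S (stage S \<delta>))"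
      using derived_subset[of S "stage S \<gamma>"] less.IH[OF \<open>\<gamma> < \<beta>\<close>] by (rule ord_le_eq_trans)
    with stage_successor[OF 2] show ?thesis
      unfolding below by auto
  next
    case 3
    have "stage S \<beta> \<subseteq> derived S (stage S \<delta>)" if \<delta>: "\<delta> < \<beta>" for \<delta>
    proof -
      obtain \<gamma> where \<gamma>: "is_successor_of \<gamma> \<delta>" "\<gamma> \<le> \<beta>"
        using \<delta> by (rule ex_successor)
      \<comment> \<open>A limit is not a successor, so the successor of \<delta> stays strictly
        below it.\<close>
      with 3 have "\<gamma> < \<beta>"
        by (metis is_limit_def order_le_less)
      then show ?thesis
        using 3 \<gamma>(1) by (auto simp: stage_limit stage_successor)
    qed
    moreover have "(\<Inter>\<delta>\<in>{..<\<beta>}. derived S (stage S \<delta>)) \<subseteq> stage S \<beta>"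
      using 3 derived_subset by (fastforce simp: stage_limit)
    ultimately show ?thesis
      by blast
  qed
qed

lemma take_in_stage: "x \<in> stage S \<beta> \<Longrightarrow> take k x \<in> stage S \<beta>"
  unfolding stage_eq_Inter_derived[of S \<beta>] by (blast intro: take_in_derived)

lemma guesser_eventually:
  assumes "guesser S G"
  shows "\<forall>\<^sub>F n in sequentially. G (initial_segment f n) = indicator S f"
  using assms by (auto simp: guesser_def tendsto_discrete)

text \<open>Without a later change the guesses along \<open>f\<close> would stay at the wrong value
  \<open>G x\<close>, contradicting convergence.\<close>

lemma guesser_changes_mind:
  assumes "guesser S G" and "extends f x" and "G x \<noteq> indicator S f"
  obtains n where "length x \<le> n" "changes_mind G f n"
proof -
  obtain N where N: "\<And>n. n \<ge> N \<Longrightarrow> G (initial_segment f n) = indicator S f"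
    using guesser_eventually[OF assms(1), of f] by (auto simp: eventually_sequentially)
  have "\<exists>n\<ge>length x. changes_mind G f n"
  proof (rule ccontr)
    assume no_change: "\<not> ?thesis"
    have "G (initial_segment f n) = G x" if "length x \<le> n" for n
      using that
    proof (induction n rule: dec_induct)
      case base
      show ?case using extendsD[OF assms(2)] by simp
    next
      case (step n)
      then show ?case using no_change by (simp add: changes_mind_def)
    qed
    from this[of "max N (length x)"] N[of "max N (length x)"] assms(3) show False
      by simp
  qed
  then show ?thesis
    using that by blast
qed

lemma stage_le_counter:
  fixes H :: "nat list \<Rightarrow> 'o::wellorder"
  assumes G: "guesser S G"
    and H_Suc: "\<And>f n. H (initial_segment f (Suc n)) \<le> H (initial_segment f n)"
    and H_change: "\<And>f n. changes_mind G f n \<Longrightarrow>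
      H (initial_segment f (Suc n)) < H (initial_segment f n)"
    and "x \<in> stage S \<beta>"
  shows "\<beta> \<le> H x"
  using \<open>x \<in> stage S \<beta>\<close>
proof (induction \<beta> arbitrary: x rule: less_induct)
  case (less \<beta>)
  show ?case
  proof (rule ccontr)
    assume "\<not> \<beta> \<le> H x"
    then have "H x < \<beta>" by simp
    with less.prems have "x \<in> derived S (stage S (H x))"
      unfolding stage_eq_Inter_derived[of S \<beta>] by blast
    then obtain f' f'' where "f' \<in> body (stage S (H x))" "f'' \<in> body (stage S (H x))"
      "extends f' x" "extends f'' x" "f' \<in> S" "f'' \<notin> S"
      by (auto simp: derived_def)
    \<comment> \<open>Whatever \<open>G x\<close> is, it is wrong for one of \<open>f'\<close> and
      \<open>f''\<close>.\<close>
    then obtain f where f: "f \<in> body (stage S (H x))" "extends f x" "G x \<noteq> indicator S f"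
      by (cases "G x = 1") auto
    then obtain n where n: "length x \<le> n" "changes_mind G f n"
      using guesser_changes_mind[OF G] by metis
    have "initial_segment f (Suc n) \<in> stage S (H x)"
      using f(1) by (simp add: body_def)
    \<comment> \<open>The induction hypothesis is used at the ordinal \<open>H x\<close>, for a
      longer sequence; the chain then closes to \<open>H x < H x\<close>.\<close>
    then have "H x \<le> H (initial_segment f (Suc n))"
      using less.IH \<open>H x < \<beta>\<close> by blast
    also have "\<dots> < H (initial_segment f n)"
      using n(2) by (rule H_change)
    also have "\<dots> \<le> H (initial_segment f (length x))"
      using n(1) by (rule lift_Suc_antimono_le[of "\<lambda>n. H (initial_segment f n)", OF H_Suc])
    finally show False
      by (simp add: extendsD[OF f(2)])
  qed
qed

lemma stage_empty_if_guessable: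
  assumes "guessable_with_less S \<alpha>"
  shows "stage S \<alpha> = {}"
proof (rule ccontr)
  assume "stage S \<alpha> \<noteq> {}"
  then obtain x where "x \<in> stage S \<alpha>" by blast
  obtain G H where GH: "guesser S G" "range H \<subseteq> {..<\<alpha>}"
    "\<forall>f n. H (initial_segment f (Suc n)) \<le> H (initial_segment f n) \<and>
      (changes_mind G f n \<longrightarrow> H (initial_segment f (Suc n)) < H (initial_segment f n))"
    using assms unfolding guessable_with_less_def by (elim exE conjE)
  have "\<alpha> \<le> H x"
    using GH(3) by (intro stage_le_counter[OF GH(1) _ _ \<open>x \<in> stage S \<alpha>\<close>]) auto
  moreover have "H x < \<alpha>"
    using GH(2) by auto
  ultimately show False by simp
qed

text \<open>Once the least value in the range is attained, the sequence can no longer drop.\<close>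

lemma antimono_eventually_const:
  fixes h :: "nat \<Rightarrow> 'o::wellorder"
  assumes "\<And>n. h (Suc n) \<le> h n"
  obtains N where "\<And>n. N \<le> n \<Longrightarrow> h n = h N"
proof -
  obtain N where "h N = (LEAST \<gamma>. \<gamma> \<in> range h)"
    using LeastI[of "\<lambda>\<gamma>. \<gamma> \<in> range h" "h 0"] by (metis rangeE rangeI)
  then have "h N \<le> h n" for n
    by (simp add: Least_le)
  then have "h n = h N" if "N \<le> n" for n
    using lift_Suc_antimono_le[of h, OF assms that] by (meson order_antisym)
  then show ?thesis
    using that by blast
qed

lemma guessable_if_stage_empty:
  fixes \<alpha> :: "'o::wellorder"
  assumes "stage S \<alpha> = {}"
  shows "guessable_with_less S \<alpha>"
proof -
  define H where "H x = (LEAST \<gamma> :: 'o. x \<notin> derived S (stage S \<gamma>))" for x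
  \<comment> \<open>Extending some prefix of rank \<open>H x\<close> is the same as extending the
    shortest one, so the quantifier over \<open>k\<close> avoids naming that prefix.\<close>
  define G :: "nat list \<Rightarrow> nat" where
    "G x = of_bool (\<exists>f \<in> S \<inter> body (stage S (H x)). \<exists>k. H (take k x) = H x \<and> extends f (take k x))"
    for x
  have ex: "\<exists>\<gamma><\<alpha>. x \<notin> derived S (stage S \<gamma>)" for x
    using assms unfolding stage_eq_Inter_derived[of S \<alpha>] by blast
  have H_notin: "x \<notin> derived S (stage S (H x))" for x
    unfolding H_def using ex[of x] by (metis (mono_tags, lifting) LeastI)
  have H_le: "H x \<le> \<gamma>" if "x \<notin> derived S (stage S \<gamma>)" for x \<gamma>
    unfolding H_def using that by (rule Least_le)
  have H_less: "H x < \<alpha>" for x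
    using ex[of x] H_le by (meson order_le_less_trans)
  have H_stage: "x \<in> stage S (H x)" for x
    unfolding stage_eq_Inter_derived[of S "H x"] using H_le by (meson INT_I lessThan_iff leD)
  have H_take: "H x \<le> H (take k x)" for x k
    using H_le H_notin take_in_derived by metis
  have H_Suc: "H (initial_segment f (Suc n)) \<le> H (initial_segment f n)" for f n
    using H_take[of "initial_segment f (Suc n)" n] by (simp add: take_initial_segment)
  have G_const: "G (initial_segment f (Suc n)) = G (initial_segment f n)"
    if H_eq: "H (initial_segment f (Suc n)) = H (initial_segment f n)" for f n
  proof -
    let ?x = "initial_segment f n" and ?y = "initial_segment f (Suc n)"
    have x: "?x = take n ?y"
      by (simp add: take_initial_segment)
    have "(\<exists>k. H (take k ?y) = H ?y \<and> extends g (take k ?y)) \<longleftrightarrow>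
          (\<exists>k. H (take k ?x) = H ?x \<and> extends g (take k ?x))" (is "?L \<longleftrightarrow> ?R") for g
    proof
      assume ?L
      then obtain k where k: "H (take k ?y) = H ?y" "extends g (take k ?y)" by blast
      show ?R
      proof (cases "k \<le> n")
        case True
        then have "take k ?x = take k ?y"
          by (simp add: take_initial_segment min_def)
        with k H_eq show ?thesis by metis
      next
        case False
        \<comment> \<open>Here \<open>take k ?y\<close> is all of \<open>?y\<close>, so
          \<open>g\<close> extends \<open>?x\<close> too, and \<open>n\<close> is a witness for
          \<open>?R\<close> because the ranks agree.\<close>
        then have "take n (take k ?y) = take n ?x"
          by (simp add: take_initial_segment min_def)
        moreover have "take n ?x = ?x"
          by simp
        ultimately show ?thesis
          using extends_take[OF k(2), of n] by metis
      qed
    next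
      assume ?R
      then show ?L
        unfolding H_eq by (metis x take_take)
    qed
    then show ?thesis
      unfolding G_def H_eq by simp
  qed
  have "guesser S G"
    unfolding guesser_def
  proof (intro conjI allI)
    show "range G \<subseteq> {0, 1}"
      by (auto simp: G_def)
  next
    fix f
    obtain N where N: "\<And>n. N \<le> n \<Longrightarrow> H (initial_segment f n) = H (initial_segment f N)"
      using antimono_eventually_const[of "\<lambda>n. H (initial_segment f n)", OF H_Suc] by blast
    define \<gamma> where "\<gamma> = H (initial_segment f N)"
    \<comment> \<open>Short segments are prefixes of segments of rank \<gamma>, and stages are
      closed under prefixes.\<close>
    have "initial_segment f n \<in> stage S \<gamma>" for n
      using take_in_stage[OF H_stage[of "initial_segment f (max n N)"], of n] N[of "max n N"]
      by (simp add: take_initial_segment \<gamma>_def)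
    then have body: "f \<in> body (stage S \<gamma>)"
      by (simp add: body_def)
    have "G (initial_segment f n) = indicator S f" if "N \<le> n" for n
    proof (cases "f \<in> S")
      case True
      have "\<exists>k. H (take k (initial_segment f n)) = \<gamma> \<and> extends f (take k (initial_segment f n))"
        using N[OF that] by (intro exI[of _ n]) (simp add: \<gamma>_def)
      then show ?thesis
        using True body N[OF that] by (auto simp: G_def \<gamma>_def)
    next
      case False
      \<comment> \<open>Otherwise \<open>g\<close> and \<open>f\<close> would put \<open>y\<close>
        into the derived set of the stage at its own rank.\<close>
      have no_ext: "\<not> extends g y" if "g \<in> S" "g \<in> body (stage S \<gamma>)" "H y = \<gamma>" "extends f y" for g y
        using that False body H_notin[of y] body_extends[OF body] by (auto simp: derived_def)
      have "extends f (take k (initial_segment f n))" for k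
        by (intro extends_take) simp
      then have "G (initial_segment f n) = 0"
        using no_ext N[OF that] by (auto simp: G_def \<gamma>_def)
      with False show ?thesis by simp
    qed
    then show "(\<lambda>n. G (initial_segment f n)) \<longlonglongrightarrow> (indicator S f :: nat)"
      by (intro tendsto_eventually) (auto simp: eventually_sequentially)
  qed
  moreover have "range H \<subseteq> {..<\<alpha>}"
    using H_less by auto
  moreover have "H (initial_segment f (Suc n)) < H (initial_segment f n)" if "changes_mind G f n" for f n
    using that G_const H_Suc by (metis changes_mind_def order_le_less)
  ultimately show ?thesis
    unfolding guessable_with_less_def using H_Suc by blast
qed

theorem theorem3p2:
  fixes S :: "(nat \<Rightarrow> nat) set" and \<alpha> :: "'o::wellorder"
  shows "guessable_with_less S \<alpha> \<longleftrightarrow> stage S \<alpha> = {}"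
  using stage_empty_if_guessable guessable_if_stage_empty by blast

end
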